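(* Let $K$ be a field of characteristic zero. For every homogeneous Artinian ideal $I\subset R=K[x,y]$, the algebra $R/I$ has the Strong Lefschetz property (and consequently also the Weak Lefschetz property).
   Context: $K[x,y]$ has the standard grading. An Artinian ideal $I\subset R$ (or $R/I$) has the Strong Lefschetz property if, for a general linear form $L$ and all $d>0$, $i\ge 0$, the map $\times L^d: (R/I)_i\to (R/I)_{i+d}$ has maximal rank (is injective or surjective). It has the Weak Lefschetz property if this holds for $d=1$ and all $i$. "General" means for all $L$ in a nonempty Zariski open subset of the space of linear forms. *)

theory Defs
  imports "HOL-Algebra.Algebraic_Closure_Type"
begin

text \<open>
  The polynomial ring \<open>R = K[x,y]\<close> is the type \<^typ>\<open>'a poly poly\<close>: the outer variable is \<open>y\<close> and
  the inner one is \<open>x\<close>, so the coefficient of \<open>x\<^sup>i y\<^sup>j\<close> in \<open>f\<close> is \<open>coeff (coeff f j) i\<close>.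
  The constant \<open>ring_of_type_algebra\<close> turns this type into a ring in the sense of \<open>HOL-Algebra\<close>,
  which makes the ideals and quotient rings of that library available.
\<close>

abbreviation Kxy :: "'a::comm_ring_1 poly poly ring"
  where "Kxy \<equiv> ring_of_type_algebra"

text \<open>The graded piece \<open>R\<^sub>d\<close>; it contains \<open>0\<close>.\<close>

definition homogeneous_part :: "nat \<Rightarrow> 'a::comm_ring_1 poly poly set"
  where "homogeneous_part d =
    {f. \<forall>i j. poly.coeff (poly.coeff f j) i \<noteq> 0 \<longrightarrow> i + j = d}"

definition homogeneous_ideal :: "'a::comm_ring_1 poly poly set \<Rightarrow> bool"
  where "homogeneous_ideal I \<longleftrightarrow>
    ideal I Kxy \<and> (\<exists>S \<subseteq> (\<Union>d. homogeneous_part d). I = Idl\<^bsub>Kxy\<^esub> S)"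

locale artinian_ring = ring +
  assumes descending_chain_condition:
    "\<lbrakk> \<And>n. ideal (J n) R; \<And>n. J (Suc n) \<subseteq> J n \<rbrakk> \<Longrightarrow> \<exists>N. \<forall>n\<ge>N. J n = J N"

definition artinian_ideal :: "'a::comm_ring_1 poly poly set \<Rightarrow> bool"
  where "artinian_ideal I \<longleftrightarrow> ideal I Kxy \<and> artinian_ring (Kxy Quot I)"

text \<open>The graded piece \<open>(R/I)\<^sub>i\<close>, i.e. the image of \<open>R\<^sub>i\<close> in \<open>R/I\<close>.\<close>

definition quotient_part :: "'a::comm_ring_1 poly poly set \<Rightarrow> nat \<Rightarrow> 'a poly poly set set"
  where "quotient_part I i = (\<lambda>f. I +>\<^bsub>Kxy\<^esub> f) ` homogeneous_part i"

definition mult_map :: "'a::comm_ring_1 poly poly set \<Rightarrow> 'a poly poly \<Rightarrow>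
    'a poly poly set \<Rightarrow> 'a poly poly set"
  where "mult_map I g C = (I +>\<^bsub>Kxy\<^esub> g) \<otimes>\<^bsub>Kxy Quot I\<^esub> C"

definition mult_max_rank :: "'a::comm_ring_1 poly poly set \<Rightarrow> 'a poly poly \<Rightarrow> nat \<Rightarrow> nat \<Rightarrow> bool"
  where "mult_max_rank I L d i \<longleftrightarrow>
    inj_on (mult_map I (L ^ d)) (quotient_part I i) \<or>
    mult_map I (L ^ d) ` quotient_part I i = quotient_part I (i + d)"

definition linear_form :: "'a::comm_ring_1 \<Rightarrow> 'a \<Rightarrow> 'a poly poly"
  where "linear_form a b = [:[:0, a:], [:b:]:]"  \<comment> \<open>\<open>a x + b y\<close>\<close>

text \<open>
  Zariski open subsets of the space of linear forms, which is identified with the affine plane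
  via \<open>a x + b y \<leftrightarrow> (a, b)\<close>: complements of the common zero set of a set \<open>S\<close> of polynomials
  in the two coordinates. The expression \<open>poly (poly F [:b:]) a\<close> is the value \<open>F(a, b)\<close>.
\<close>

definition zariski_open_linear_forms :: "'a::comm_ring_1 poly poly set \<Rightarrow> bool"
  where "zariski_open_linear_forms U \<longleftrightarrow>
    (\<exists>S :: 'a poly poly set. U = {linear_form a b | a b. \<exists>F\<in>S. poly (poly F [:b:]) a \<noteq> 0})"

definition for_general_linear_form :: "('a::comm_ring_1 poly poly \<Rightarrow> bool) \<Rightarrow> bool"
  where "for_general_linear_form P \<longleftrightarrow>
    (\<exists>U. zariski_open_linear_forms U \<and> U \<noteq> {} \<and> (\<forall>L\<in>U. P L))"

definition strong_lefschetz :: "'a::comm_ring_1 poly poly set \<Rightarrow> bool"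
  where "strong_lefschetz I \<longleftrightarrow>
    for_general_linear_form (\<lambda>L. \<forall>d>0. \<forall>i. mult_max_rank I L d i)"

definition weak_lefschetz :: "'a::comm_ring_1 poly poly set \<Rightarrow> bool"
  where "weak_lefschetz I \<longleftrightarrow>
    for_general_linear_form (\<lambda>L. \<forall>i. mult_max_rank I L 1 i)"

end

theory Submission
  imports Defs
begin

text \<open>
  Put \<open>n = i + d\<close> and dehomogenise: \<open>R\<^sub>n\<close> becomes the space of polynomials of degree at most \<open>n\<close>
  in one variable, \<open>I\<^sub>n\<close> a subspace \<open>V\<close> of it, of dimension \<open>r\<close> say, and \<open>a x + b y\<close> a multiple of
  \<open>X - t\<close> with \<open>t = - b / a\<close>. In characteristic zero, for all but finitely many \<open>t\<close> the vanishing
  orders of \<open>V\<close> at \<open>t\<close> are \<open>0, \<dots>, r - 1\<close>, i.e. \<open>V\<close> maps isomorphically onto \<open>K[X]/(X - t)\<^sup>r\<close>. So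
  if \<open>d \<ge> r\<close>, no nonzero element of \<open>I\<^sub>n\<close> is divisible by \<open>L\<^sup>d\<close> and multiplication by \<open>L\<^sup>d\<close> into
  degree \<open>n\<close> is injective, while if \<open>d \<le> r\<close>, then \<open>I\<^sub>n + L\<^sup>d R\<^sub>i = R\<^sub>n\<close> and it is surjective. Only
  finitely many \<open>n\<close> matter, since \<open>R\<^sub>n \<subseteq> I\<close> for large \<open>n\<close> by the Artinian hypothesis.

  The claim on vanishing orders is proved by induction on the dimension: for \<open>f \<in> V\<close> with
  \<open>f(t) \<noteq> 0\<close>, the map \<open>g \<mapsto> g' f - g f'\<close> kills exactly the multiples of \<open>f\<close> and lowers positive
  vanishing orders at \<open>t\<close> by exactly one.
\<close>

section \<open>Spans of univariate polynomials and their vanishing orders at a point\<close>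

fun lin_span :: "'a::field poly list \<Rightarrow> 'a poly set" where
  "lin_span [] = {0}"
| "lin_span (f # fs) = {Polynomial.smult c f + v | c v. v \<in> lin_span fs}"

text \<open>Up to the factor \<open>f^2\<close> this is the derivative of the quotient
  \<open>g / f\<close>.\<close>

definition wronskian :: "'a::field poly \<Rightarrow> 'a poly \<Rightarrow> 'a poly"
  where "wronskian f g = pderiv g * f - g * pderiv f"

lemma wronskian_add: "wronskian f (g + h) = wronskian f g + wronskian f h"
  by (simp add: wronskian_def pderiv_add algebra_simps)

lemma wronskian_diff: "wronskian f (g - h) = wronskian f g - wronskian f h"
  by (simp add: wronskian_def pderiv_diff algebra_simps)

lemma wronskian_smult: "wronskian f (Polynomial.smult c g) = Polynomial.smult c (wronskian f g)"
  by (simp add: wronskian_def pderiv_smult smult_diff_right)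

lemma wronskian_self: "wronskian f f = 0"
  by (simp add: wronskian_def)

text \<open>Makes an induction on the length of the list possible: the image space is again given by
  a list, as long as \<open>gs\<close>.\<close>

lemma lin_span_map_wronskian: "lin_span (map (wronskian f) gs) = wronskian f ` lin_span gs"
proof (induction gs)
  case Nil
  then show ?case by (simp add: wronskian_def)
next
  case (Cons g gs)
  show ?case
    unfolding list.map lin_span.simps Cons.IH
    by (force simp: wronskian_add wronskian_smult)
qed

lemma lin_span_subset_Cons: "v \<in> lin_span fs \<Longrightarrow> Polynomial.smult c f + v \<in> lin_span (f # fs)"
  by auto

text \<open>Induction on the degree bound: the elements with vanishing \<open>n\<close>-th
  coefficient form the kernel of a linear functional on \<open>V\<close>, so at most one further
  generator is needed.\<close>

lemma subspace_eq_lin_span: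
  fixes V :: "'a::field poly set"
  assumes "0 \<in> V" and "\<And>v w. \<lbrakk>v \<in> V; w \<in> V\<rbrakk> \<Longrightarrow> v + w \<in> V"
    and "\<And>c v. v \<in> V \<Longrightarrow> Polynomial.smult c v \<in> V"
    and "\<And>v i. \<lbrakk>v \<in> V; n \<le> i\<rbrakk> \<Longrightarrow> poly.coeff v i = 0"
  shows "\<exists>fs. V = lin_span fs"
  using assms
proof (induction n arbitrary: V)
  case 0
  then have "V = {0}"
    by (auto intro!: poly_eqI)
  then show ?case by (metis lin_span.simps(1))
next
  case (Suc n)
  define V' where "V' = {v \<in> V. poly.coeff v n = 0}"
  have "\<exists>fs. V' = lin_span fs"
  proof (rule Suc.IH)
    fix v i assume "v \<in> V'" "n \<le> i"
    then show "poly.coeff v i = 0"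
      using Suc.prems(4)[of v i] by (cases "i = n") (auto simp: V'_def)
  qed (use Suc.prems(1-3) in \<open>auto simp: V'_def\<close>)
  then obtain fs where fs: "V' = lin_span fs" by blast
  show ?case
  proof (cases "V' = V")
    case True
    then show ?thesis using fs by blast
  next
    case False
    then obtain f where f: "f \<in> V" "poly.coeff f n \<noteq> 0"
      by (auto simp: V'_def)
    have "V = lin_span (f # fs)"
    proof (intro equalityI subsetI)
      fix v assume v: "v \<in> V"
      define c where "c = poly.coeff v n / poly.coeff f n"
      have "v + Polynomial.smult (- c) f \<in> V"
        by (intro Suc.prems(2,3) v f(1))
      then have "v + Polynomial.smult (- c) f \<in> V'"
        using f(2) by (simp add: V'_def c_def)
      then have "Polynomial.smult c f + (v + Polynomial.smult (- c) f) \<in> lin_span (f # fs)"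
        unfolding fs by (rule lin_span_subset_Cons)
      then show "v \<in> lin_span (f # fs)" by simp
    next
      fix v assume "v \<in> lin_span (f # fs)"
      then show "v \<in> V"
        using Suc.prems(2,3) f(1) by (auto simp: fs[symmetric] V'_def)
    qed
    then show ?thesis by blast
  qed
qed

text \<open>Differentiation lowers the vanishing order at \<open>t\<close> by at most one.\<close>

lemma power_dvd_wronskian:
  fixes f v :: "'a::field poly"
  assumes "[:-t, 1:] ^ Suc n dvd v"
  shows "[:-t, 1:] ^ n dvd wronskian f v"
proof -
  define p where "p = [:-t, 1:]"
  obtain u where u: "v = p ^ Suc n * u"
    using assms unfolding p_def by (elim dvdE)
  have "pderiv v = p ^ n * (p * pderiv u + Polynomial.smult (of_nat (Suc n)) (u * pderiv p))"
    unfolding u pderiv_mult pderiv_power_Suc by (simp add: algebra_simps)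
  then have "[:-t, 1:] ^ n dvd pderiv v" by (simp add: p_def)
  moreover have "[:-t, 1:] ^ n dvd v"
    using assms by (rule power_le_dvd) simp
  ultimately show ?thesis
    unfolding wronskian_def by (intro dvd_diff dvd_mult2) auto
qed

text \<open>If \<open>q\<close> vanishes at \<open>t\<close> to order exactly \<open>k + 1\<close>,
  then its Wronskian with \<open>f\<close> vanishes to order exactly \<open>k\<close>, whence
  \<open>n \<le> k\<close>.\<close>

lemma power_dvd_of_wronskian:
  fixes f q :: "'a::field_char_0 poly"
  assumes "poly f t \<noteq> 0" and "poly q t = 0" and dvd: "[:-t, 1:] ^ n dvd wronskian f q"
  shows "[:-t, 1:] ^ Suc n dvd q"
proof (cases "q = 0")
  case False
  obtain k where k: "order t q = Suc k"
    using False assms(2) order_root[of q t] by (cases "order t q") auto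
  obtain u where u: "q = [:-t, 1:] ^ Suc k * u" "\<not> [:-t, 1:] dvd u"
    using order_decomp[OF False, of t] k by metis
  define p where "p = [:-t, 1:]"
  define w where "w = p * pderiv u * f + Polynomial.smult (of_nat (Suc k)) (u * f) - p * u * pderiv f"
  have pd: "pderiv p = 1" by (simp add: p_def pderiv_pCons)
  have W: "wronskian f q = p ^ k * w"
    unfolding wronskian_def u(1) p_def[symmetric] pderiv_mult pderiv_power_Suc pd w_def
    by (simp add: algebra_simps smult_add_left)
  \<comment> \<open>At \<open>t\<close> only \<open>(k + 1) u(t) f(t)\<close> survives; it is
    nonzero because the characteristic is zero.\<close>
  have "poly w t \<noteq> 0"
    using u(2) assms(1) by (simp add: w_def p_def poly_eq_0_iff_dvd del: of_nat_Suc)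
  then have "\<not> p dvd w" by (simp add: p_def poly_eq_0_iff_dvd)
  have "n \<le> k"
  proof (rule ccontr)
    assume "\<not> n \<le> k"
    then have "Suc k \<le> n" by simp
    with dvd have "p ^ Suc k dvd p ^ k * w"
      unfolding W p_def[symmetric] by (rule power_le_dvd)
    moreover have "p \<noteq> 0" by (simp add: p_def)
    ultimately have "p dvd w" by (simp add: power_Suc2 del: power_Suc)
    with \<open>\<not> p dvd w\<close> show False ..
  qed
  then show ?thesis using k by (simp add: order_divides del: power_Suc)
qed simp

text \<open>The conjuncts state that the span maps injectively and surjectively to
  \<open>K[X]/(X - t)^r\<close>, so \<open>r\<close> is its dimension. The Wronskian with the head
  \<open>f\<close> kills \<open>f\<close>, which leaves the image of the span of the tail, to which
  the induction hypothesis applies.\<close>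

lemma lin_span_generic:
  fixes fs :: "'a::field_char_0 poly list"
  shows "\<exists>r T. finite T \<and> (\<forall>t. t \<notin> T \<longrightarrow>
    (\<forall>v\<in>lin_span fs. [:-t, 1:] ^ r dvd v \<longrightarrow> v = 0) \<and>
    (\<forall>h. \<exists>v\<in>lin_span fs. [:-t, 1:] ^ r dvd h - v))"
proof (induction "length fs" arbitrary: fs)
  case 0
  then show ?case by (intro exI[of _ 0] exI[of _ "{}"]) auto
next
  case (Suc n)
  then obtain f gs where fs: "fs = f # gs" and n: "n = length gs"
    by (cases fs) auto
  show ?case
  \<comment> \<open>Lists may be linearly dependent, so a zero head can arise among the Wronskians;
    it is simply dropped.\<close>
  proof (cases "f = 0")
    case True
    then have "lin_span fs = lin_span gs" by (simp add: fs)
    then show ?thesis using Suc.hyps(1)[OF n] by simp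
  next
    case False
    obtain r T where T: "finite T"
      and inj: "\<And>t v. \<lbrakk>t \<notin> T; v \<in> lin_span gs; [:-t, 1:] ^ r dvd wronskian f v\<rbrakk> \<Longrightarrow> wronskian f v = 0"
      and surj: "\<And>t h. t \<notin> T \<Longrightarrow> \<exists>v\<in>lin_span gs. [:-t, 1:] ^ r dvd h - wronskian f v"
      using Suc.hyps(1)[of "map (wronskian f) gs"] n unfolding lin_span_map_wronskian
      by auto metis
    have "(\<forall>v\<in>lin_span fs. [:-t, 1:] ^ Suc r dvd v \<longrightarrow> v = 0) \<and>
        (\<forall>h. \<exists>v\<in>lin_span fs. [:-t, 1:] ^ Suc r dvd h - v)"
      if t: "t \<notin> T \<union> {t. poly f t = 0}" for t
    proof (intro conjI ballI impI allI)
      fix v assume v: "v \<in> lin_span fs" and dvd: "[:-t, 1:] ^ Suc r dvd v"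
      obtain c w where w: "v = Polynomial.smult c f + w" "w \<in> lin_span gs"
        using v by (auto simp: fs)
      have "wronskian f v = wronskian f w"
        by (simp add: w wronskian_add wronskian_smult wronskian_self)
      then have "wronskian f v = 0"
        using inj[of t w] t w power_dvd_wronskian[OF dvd, of f] by simp
      moreover have "poly v t = 0"
        using dvd by (metis dvd_mult_left poly_eq_0_iff_dvd power_Suc)
      \<comment> \<open>The zero Wronskian is divisible by every power, in particular by one that
        yields more than the order of \<open>v\<close> at \<open>t\<close>; this forces
        \<open>v = 0\<close>.\<close>
      ultimately have "[:-t, 1:] ^ Suc (order t v) dvd v"
        using t by (intro power_dvd_of_wronskian[of f]) auto
      then show "v = 0" by (simp add: order_divides del: power_Suc)
    next
      fix h
      obtain g where g: "g \<in> lin_span gs" "[:-t, 1:] ^ r dvd wronskian f h - wronskian f g"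
        using surj t by blast
      \<comment> \<open>Adding a multiple of \<open>f\<close> leaves the Wronskian unchanged; this
        multiple makes \<open>q\<close> vanish at \<open>t\<close>, as
        \<open>power_dvd_of_wronskian\<close> requires.\<close>
      define c where "c = poly (h - g) t / poly f t"
      define q where "q = h - (Polynomial.smult c f + g)"
      have "wronskian f q = wronskian f h - wronskian f g"
        by (simp add: q_def wronskian_diff wronskian_add wronskian_smult wronskian_self)
      then have "[:-t, 1:] ^ Suc r dvd q"
        using t g(2) by (intro power_dvd_of_wronskian[of f]) (auto simp: q_def c_def)
      then show "\<exists>v\<in>lin_span fs. [:-t, 1:] ^ Suc r dvd h - v"
        using g(1) unfolding q_def fs by (blast intro: lin_span_subset_Cons)
    qed
    moreover have "finite (T \<union> {t. poly f t = 0})"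
      using T False by (simp add: poly_roots_finite)
    ultimately show ?thesis by blast
  qed
qed

section \<open>Homogeneous components and graded pieces\<close>

lemma coeff_coeff_mult:
  "poly.coeff (poly.coeff (g * f) j) i =
    (\<Sum>a\<le>j. \<Sum>b\<le>i. poly.coeff (poly.coeff g a) b * poly.coeff (poly.coeff f (j - a)) (i - b))"
  by (simp add: Polynomial.coeff_mult Polynomial.coeff_sum)

definition homogeneous_component :: "nat \<Rightarrow> 'a::comm_ring_1 poly poly \<Rightarrow> 'a poly poly"
  where "homogeneous_component k f =
    (\<Sum>j\<le>k. Polynomial.monom (Polynomial.monom (poly.coeff (poly.coeff f j) (k - j)) (k - j)) j)"

lemma coeff_homogeneous_component:
  "poly.coeff (poly.coeff (homogeneous_component k f) j) i =
    (if i + j = k then poly.coeff (poly.coeff f j) i else 0)"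
proof -
  have "poly.coeff (poly.coeff (homogeneous_component k f) j) i =
      (\<Sum>m\<le>k. if m = j then (if k - m = i then poly.coeff (poly.coeff f m) (k - m) else 0) else 0)"
    unfolding homogeneous_component_def Polynomial.coeff_sum
    by (intro sum.cong) auto
  also have "\<dots> = (if i + j = k then poly.coeff (poly.coeff f j) i else 0)"
    by (subst sum.delta) auto
  finally show ?thesis .
qed

lemma homogeneous_component_add:
  "homogeneous_component k (f + g) = homogeneous_component k f + homogeneous_component k g"
  by (intro poly_eqI) (simp add: coeff_homogeneous_component)

lemma homogeneous_component_diff:
  "homogeneous_component k (f - g) = homogeneous_component k f - homogeneous_component k g"
  by (intro poly_eqI) (simp add: coeff_homogeneous_component)

lemma homogeneous_component_homogeneous:
  assumes "f \<in> homogeneous_part d"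
  shows "homogeneous_component k f = (if k = d then f else 0)"
  using assms by (intro poly_eqI) (auto simp: coeff_homogeneous_component homogeneous_part_def)

text \<open>Coefficientwise, with the sum over \<open>m\<close> moved innermost, only
  \<open>m = b + a\<close> contributes, the degree of the monomial taken from
  \<open>g\<close>.\<close>

lemma homogeneous_component_mult:
  "homogeneous_component k (g * f) =
    (\<Sum>m\<le>k. homogeneous_component m g * homogeneous_component (k - m) f)"
proof (intro poly_eqI)
  fix j i
  let ?c = "\<lambda>f j i. poly.coeff (poly.coeff f j) i"
  have "?c (\<Sum>m\<le>k. homogeneous_component m g * homogeneous_component (k - m) f) j i =
    (\<Sum>m\<le>k. \<Sum>a\<le>j. \<Sum>b\<le>i. (if b + a = m then ?c g a b else 0) *
      (if i - b + (j - a) = k - m then ?c f (j - a) (i - b) else 0))"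
    by (simp add: Polynomial.coeff_sum coeff_coeff_mult coeff_homogeneous_component
        del: Polynomial.coeff_mult)
  also have "\<dots> = (\<Sum>a\<le>j. \<Sum>b\<le>i. \<Sum>m\<le>k. (if b + a = m then ?c g a b else 0) *
      (if i - b + (j - a) = k - m then ?c f (j - a) (i - b) else 0))"
    by (subst sum.swap, rule sum.cong[OF refl], rule sum.swap)
  also have "\<dots> = (\<Sum>a\<le>j. \<Sum>b\<le>i. if i + j = k then ?c g a b * ?c f (j - a) (i - b) else 0)"
  proof (intro sum.cong refl)
    fix a b assume ab: "a \<in> {..j}" "b \<in> {..i}"
    have "(\<Sum>m\<le>k. (if b + a = m then ?c g a b else 0) *
        (if i - b + (j - a) = k - m then ?c f (j - a) (i - b) else 0)) =
      (\<Sum>m\<le>k. if m = b + a then ?c g a b *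
        (if i - b + (j - a) = k - (b + a) then ?c f (j - a) (i - b) else 0) else 0)"
      by (intro sum.cong) auto
    \<comment> \<open>Truncated subtraction is harmless: if \<open>b + a > k\<close>, the sum is
      zero, and \<open>i + j = k\<close> fails too because \<open>b \<le> i\<close> and
      \<open>a \<le> j\<close>.\<close>
    also have "\<dots> = (if i + j = k then ?c g a b * ?c f (j - a) (i - b) else 0)"
      using ab by (subst sum.delta) auto
    finally show "(\<Sum>m\<le>k. (if b + a = m then ?c g a b else 0) *
        (if i - b + (j - a) = k - m then ?c f (j - a) (i - b) else 0)) = \<dots>" .
  qed
  also have "\<dots> = ?c (homogeneous_component k (g * f)) j i"
    by (simp add: coeff_homogeneous_component coeff_coeff_mult)
  finally show "?c (homogeneous_component k (g * f)) j i =
    ?c (\<Sum>m\<le>k. homogeneous_component m g * homogeneous_component (k - m) f) j i" ..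
qed

lemma homogeneous_part_mult:
  assumes "f \<in> homogeneous_part d" "g \<in> homogeneous_part e"
  shows "f * g \<in> homogeneous_part (d + e)"
proof -
  have "i + j = d + e" if nz: "poly.coeff (poly.coeff (f * g) j) i \<noteq> 0" for i j
  proof -
    obtain a where a: "a \<in> {..j}"
      "(\<Sum>b\<le>i. poly.coeff (poly.coeff f a) b * poly.coeff (poly.coeff g (j - a)) (i - b)) \<noteq> 0"
      using nz unfolding coeff_coeff_mult by (rule sum.not_neutral_contains_not_neutral)
    obtain b where b: "b \<in> {..i}"
      "poly.coeff (poly.coeff f a) b * poly.coeff (poly.coeff g (j - a)) (i - b) \<noteq> 0"
      using a(2) by (rule sum.not_neutral_contains_not_neutral)
    then have "poly.coeff (poly.coeff f a) b \<noteq> 0"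
        "poly.coeff (poly.coeff g (j - a)) (i - b) \<noteq> 0" by auto
    then have "b + a = d" "i - b + (j - a) = e"
      using assms by (auto simp: homogeneous_part_def)
    then show ?thesis using a(1) b(1) by simp
  qed
  then show ?thesis by (auto simp: homogeneous_part_def)
qed

lemma homogeneous_part_diff:
  "\<lbrakk>f \<in> homogeneous_part d; g \<in> homogeneous_part d\<rbrakk> \<Longrightarrow> f - g \<in> homogeneous_part d"
  by (force simp: homogeneous_part_def)

lemma homogeneous_part_add:
  "\<lbrakk>f \<in> homogeneous_part d; g \<in> homogeneous_part d\<rbrakk> \<Longrightarrow> f + g \<in> homogeneous_part d"
  by (force simp: homogeneous_part_def)

lemma linear_form_power_homogeneous: "linear_form a b ^ d \<in> homogeneous_part d"
proof (induction d)
  case 0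
  show ?case by (auto simp: homogeneous_part_def coeff_1 split: if_splits)
next
  case (Suc d)
  have "linear_form a b \<in> homogeneous_part 1"
    by (auto simp: homogeneous_part_def linear_form_def coeff_pCons split: nat.splits)
  from homogeneous_part_mult[OF this Suc] show ?case by simp
qed

text \<open>Dehomogenisation at \<open>y = 1\<close> is evaluation of the outer variable.\<close>

lemma coeff_poly_1_homogeneous:
  fixes f :: "'a::comm_ring_1 poly poly"
  assumes "f \<in> homogeneous_part d"
  shows "poly.coeff (poly f 1) i = (if i \<le> d then poly.coeff (poly.coeff f (d - i)) i else 0)"
proof -
  have "poly.coeff (poly f 1) i = (\<Sum>k\<le>Polynomial.degree f. poly.coeff (poly.coeff f k) i)"
    by (simp add: poly_altdef Polynomial.coeff_sum)
  also have "\<dots> = (\<Sum>k\<le>Polynomial.degree f. if k = d - i then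
      (if i \<le> d then poly.coeff (poly.coeff f (d - i)) i else 0) else 0)"
  proof -
    have "poly.coeff (poly.coeff f k) i = 0" if "i + k \<noteq> d" for k
      using assms that by (auto simp: homogeneous_part_def)
    then show ?thesis by (intro sum.cong) auto
  qed
  also have "\<dots> = (if i \<le> d then poly.coeff (poly.coeff f (d - i)) i else 0)"
    by (subst sum.delta) (auto simp: not_le coeff_eq_0)
  finally show ?thesis .
qed

text \<open>Dehomogenisation loses nothing within one graded piece, so identities between forms of
  equal degree can be checked at \<open>y = 1\<close>.\<close>

lemma homogeneous_eq_0_if_poly_1:
  fixes f :: "'a::comm_ring_1 poly poly"
  assumes f: "f \<in> homogeneous_part d" and "poly f 1 = 0"
  shows "f = 0"
proof (intro poly_eqI)
  fix j i
  show "poly.coeff (poly.coeff f j) i = poly.coeff (poly.coeff 0 j) i"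
  proof (cases "i + j = d")
    case True
    then show ?thesis using coeff_poly_1_homogeneous[OF f, of i] assms(2) by auto
  qed (use f in \<open>auto simp: homogeneous_part_def\<close>)
qed

text \<open>The witness pads each monomial with the missing power of \<open>y\<close>.\<close>

lemma ex_homogeneous_poly_1:
  fixes p :: "'a::comm_ring_1 poly"
  assumes "Polynomial.degree p \<le> d"
  shows "\<exists>f\<in>homogeneous_part d. poly f 1 = p"
proof
  define f where "f = (\<Sum>i\<le>d. Polynomial.monom (Polynomial.monom (poly.coeff p i) i) (d - i))"
  show "f \<in> homogeneous_part d"
  proof -
    have "i + j = d" if nz: "poly.coeff (poly.coeff f j) i \<noteq> 0" for i j
    proof -
      obtain k where "k \<in> {..d}" "poly.coeff (poly.coeff
          (Polynomial.monom (Polynomial.monom (poly.coeff p k) k) (d - k)) j) i \<noteq> 0"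
        using nz unfolding f_def Polynomial.coeff_sum
        by (rule sum.not_neutral_contains_not_neutral)
      then show ?thesis by (auto split: if_splits)
    qed
    then show ?thesis by (auto simp: homogeneous_part_def)
  qed
  show "poly f 1 = p"
    using poly_as_sum_of_monoms'[OF assms] by (simp add: f_def poly_sum poly_monom)
qed

section \<open>Ideals and cosets expressed by the type class operations\<close>

lemma ideal_KxyD:
  assumes "ideal I (Kxy :: 'a::comm_ring_1 poly poly ring)"
  shows ideal_Kxy_zero: "0 \<in> I"
    and ideal_Kxy_add: "\<lbrakk>f \<in> I; g \<in> I\<rbrakk> \<Longrightarrow> f + g \<in> I"
    and ideal_Kxy_mult: "f \<in> I \<Longrightarrow> g * f \<in> I"
  using assms additive_subgroup.zero_closed[of I Kxy] additive_subgroup.a_closed[of I Kxy f g]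
    ideal.I_l_closed[of I Kxy f g]
  by (auto simp: ring_of_type_algebra_def ideal_def)

lemma ideal_Kxy_diff:
  fixes I :: "'a::comm_ring_1 poly poly set"
  assumes "ideal I Kxy" "f \<in> I" "g \<in> I"
  shows "f - g \<in> I"
  using ideal_Kxy_add[OF assms(1,2) ideal_Kxy_mult[OF assms(1,3), of "-1"]] by simp

lemma ideal_KxyI:
  fixes I :: "'a::comm_ring_1 poly poly set"
  assumes "0 \<in> I" "\<And>f g. \<lbrakk>f \<in> I; g \<in> I\<rbrakk> \<Longrightarrow> f + g \<in> I" "\<And>f g. f \<in> I \<Longrightarrow> g * f \<in> I"
  shows "ideal I Kxy"
proof -
  interpret R: ring "Kxy :: 'a poly poly ring" by (rule ring_from_type_algebra)
  have inv: "\<ominus>\<^bsub>Kxy\<^esub> f = - f" for f :: "'a poly poly"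
    by (rule R.minus_equality) (auto simp: ring_of_type_algebra_def)
  show ?thesis
  proof (rule idealI)
    show "subgroup I (add_monoid Kxy)"
    proof (rule R.add.subgroupI)
      fix f assume "f \<in> I"
      then show "\<ominus>\<^bsub>Kxy\<^esub> f \<in> I"
        using assms(3)[of f "-1"] by (simp add: inv)
    qed (use assms in \<open>auto simp: ring_of_type_algebra_def\<close>)
  next
    fix a x assume "a \<in> I"
    then show "x \<otimes>\<^bsub>Kxy\<^esub> a \<in> I" "a \<otimes>\<^bsub>Kxy\<^esub> x \<in> I"
      using assms(3)[of a x] by (auto simp: ring_of_type_algebra_def mult.commute)
  qed (rule R.ring_axioms)
qed

lemma coset_Kxy_eq_iff:
  fixes I :: "'a::comm_ring_1 poly poly set"
  assumes "ideal I Kxy"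
  shows "I +>\<^bsub>Kxy\<^esub> f = I +>\<^bsub>Kxy\<^esub> g \<longleftrightarrow> f - g \<in> I"
proof -
  have coset: "h \<in> I +>\<^bsub>Kxy\<^esub> f \<longleftrightarrow> h - f \<in> I" for h f
    by (auto simp: a_r_coset_def' ring_of_type_algebra_def intro: bexI[of _ "h - f"])
  show ?thesis
  proof
    assume "I +>\<^bsub>Kxy\<^esub> f = I +>\<^bsub>Kxy\<^esub> g"
    moreover have "f \<in> I +>\<^bsub>Kxy\<^esub> f" by (simp add: coset ideal_Kxy_zero[OF assms])
    ultimately show "f - g \<in> I" by (simp add: coset)
  next
    assume *: "f - g \<in> I"
    have "h - f \<in> I \<longleftrightarrow> h - g \<in> I" for h
      using ideal_Kxy_add[OF assms _ *, of "h - f"] ideal_Kxy_diff[OF assms _ *, of "h - g"] by auto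
    then show "I +>\<^bsub>Kxy\<^esub> f = I +>\<^bsub>Kxy\<^esub> g" by (auto simp: coset)
  qed
qed

lemma mult_map_coset:
  fixes I :: "'a::comm_ring_1 poly poly set"
  assumes "ideal I Kxy"
  shows "mult_map I g (I +>\<^bsub>Kxy\<^esub> f) = I +>\<^bsub>Kxy\<^esub> (g * f)"
  using ideal.rcoset_mult_add[OF assms, of g f]
  by (simp add: mult_map_def FactRing_def) (simp add: ring_of_type_algebra_def)

section \<open>Homogeneous Artinian ideals\<close>

text \<open>The polynomials with all components in \<open>I\<close> form an ideal \<open>J\<close>
  that contains the homogeneous generators, hence all of \<open>I\<close>.\<close>

lemma homogeneous_ideal_component:
  assumes "homogeneous_ideal I" and "f \<in> I"
  shows "homogeneous_component k f \<in> I"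
proof -
  have I: "ideal I Kxy" using assms(1) by (simp add: homogeneous_ideal_def)
  obtain S where S: "S \<subseteq> (\<Union>d. homogeneous_part d)" "I = Idl\<^bsub>Kxy\<^esub> S"
    using assms(1) by (auto simp: homogeneous_ideal_def)
  interpret R: ring "Kxy :: 'a poly poly ring" by (rule ring_from_type_algebra)
  define J where "J = {f. \<forall>k. homogeneous_component k f \<in> I}"
  have "S \<subseteq> I" unfolding S(2) by (rule R.genideal_self) (simp add: ring_of_type_algebra_def)
  have "ideal J Kxy"
  proof (rule ideal_KxyI)
    have "homogeneous_component k (0::'a poly poly) = 0" for k
      by (simp add: homogeneous_component_def)
    then show "0 \<in> J" by (simp add: J_def ideal_Kxy_zero[OF I])
  next
    fix f g assume "f \<in> J" "g \<in> J"
    then show "f + g \<in> J"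
      by (simp add: J_def homogeneous_component_add ideal_Kxy_add[OF I])
  next
    fix f g assume "f \<in> J"
    \<comment> \<open>The index set is decoupled from \<open>k\<close>, which also occurs in the
      summand, so that induction on finite sets applies.\<close>
    have "(\<Sum>m\<in>A. homogeneous_component m g * homogeneous_component (k - m) f) \<in> I"
      if "finite A" for A k
      using that by induction
        (use \<open>f \<in> J\<close> in \<open>auto simp: J_def intro: ideal_Kxy_zero[OF I] ideal_Kxy_add[OF I] ideal_Kxy_mult[OF I]\<close>)
    then show "g * f \<in> J" by (simp add: J_def homogeneous_component_mult)
  qed
  moreover have "S \<subseteq> J"
  proof
    fix f assume "f \<in> S"
    then obtain d where "f \<in> homogeneous_part d" using S(1) by blast
    then show "f \<in> J"
      using \<open>f \<in> S\<close> \<open>S \<subseteq> I\<close> ideal_Kxy_zero[OF I]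
      by (auto simp: J_def homogeneous_component_homogeneous)
  qed
  ultimately have "I \<subseteq> J" unfolding S(2) by (rule R.genideal_minimal)
  then show ?thesis using assms(2) by (auto simp: J_def)
qed

text \<open>Here \<open>M n\<close> is the power \<open>(x, y)^n\<close>. Its images in
  \<open>R/I\<close> form a descending chain; once it is stable, a form \<open>f\<close> of degree
  \<open>n\<close> is congruent modulo \<open>I\<close> to some \<open>g\<close> with terms of
  degree above \<open>n\<close> only, and \<open>f\<close> is the component of degree
  \<open>n\<close> of \<open>f - g\<close>.\<close>

lemma artinian_homogeneous_ideal_contains_parts:
  fixes I :: "'a::comm_ring_1 poly poly set"
  assumes hom: "homogeneous_ideal I" and art: "artinian_ideal I"
  shows "\<exists>N. \<forall>n\<ge>N. homogeneous_part n \<subseteq> I"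
proof -
  have I: "ideal I Kxy" using hom by (simp add: homogeneous_ideal_def)
  interpret R: ring "Kxy :: 'a poly poly ring" by (rule ring_from_type_algebra)
  define M where "M n = {f :: 'a poly poly. \<forall>i j. i + j < n \<longrightarrow> poly.coeff (poly.coeff f j) i = 0}" for n
  define J where "J n = (+>\<^bsub>Kxy\<^esub>) I ` M n" for n
  have "ideal (M n) Kxy" for n
  proof (rule ideal_KxyI)
    fix f g assume "f \<in> M n"
    then show "g * f \<in> M n"
      by (auto simp: M_def coeff_coeff_mult intro!: sum.neutral)
  qed (auto simp: M_def)
  then have "ideal (J n) (Kxy Quot I)" for n
    unfolding J_def by (rule R.ring_ideal_imp_quot_ideal[OF I])
  moreover have "J (Suc n) \<subseteq> J n" for n
    unfolding J_def by (rule image_mono) (auto simp: M_def)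
  ultimately obtain N where N: "\<And>n. n \<ge> N \<Longrightarrow> J n = J N"
    using art artinian_ring.descending_chain_condition[of "Kxy Quot I" J]
    by (auto simp: artinian_ideal_def)
  have "f \<in> I" if "n \<ge> N" and f: "f \<in> homogeneous_part n" for f n
  proof -
    have "f \<in> M n" using f by (force simp: M_def homogeneous_part_def)
    then have "I +>\<^bsub>Kxy\<^esub> f \<in> J (Suc n)"
      using N[of n] N[of "Suc n"] that(1) by (auto simp: J_def)
    then obtain g where g: "g \<in> M (Suc n)" "f - g \<in> I"
      by (auto simp: J_def coset_Kxy_eq_iff[OF I])
    have "homogeneous_component n g = 0"
      using g(1) by (intro poly_eqI) (auto simp: coeff_homogeneous_component M_def)
    then show "f \<in> I"
      using homogeneous_ideal_component[OF hom g(2), of n] homogeneous_component_homogeneous[OF f, of n]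
      by (simp add: homogeneous_component_diff)
  qed
  then show ?thesis by blast
qed

section \<open>Maximal rank into a fixed degree\<close>

text \<open>The space \<open>V\<close> depends on \<open>n\<close> alone, so one exceptional set
  serves every splitting \<open>n = i + d\<close>; only the comparison of \<open>d\<close> with
  \<open>r\<close> varies.\<close>

lemma mult_max_rank_generic:
  fixes I :: "'a::field_char_0 poly poly set"
  assumes I: "ideal I Kxy"
  shows "\<exists>T. finite T \<and> (\<forall>a b d i. a \<noteq> 0 \<longrightarrow> - b / a \<notin> T \<longrightarrow> i + d = n \<longrightarrow>
    mult_max_rank I (linear_form a b) d i)"
proof -
  define V where "V = (\<lambda>f. poly f 1) ` (I \<inter> homogeneous_part n)"
  have "\<exists>fs. V = lin_span fs"
  \<comment> \<open>The bound in that lemma is exclusive, while degree \<open>n\<close> itself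
    occurs in \<open>V\<close>.\<close>
  proof (rule subspace_eq_lin_span[where n = "Suc n"])
    show "0 \<in> V"
      unfolding V_def by (rule image_eqI[of _ _ 0]) (auto simp: ideal_Kxy_zero[OF I] homogeneous_part_def)
    show "v + w \<in> V" if "v \<in> V" "w \<in> V" for v w
      using that unfolding V_def
      by (auto simp flip: poly_add intro!: imageI ideal_Kxy_add[OF I] homogeneous_part_add)
    show "Polynomial.smult c v \<in> V" if "v \<in> V" for c v
    proof -
      obtain f where f: "v = poly f 1" "f \<in> I" "f \<in> homogeneous_part n"
        using \<open>v \<in> V\<close> by (auto simp: V_def)
      have "[:[:c:]:] * f \<in> I" by (rule ideal_Kxy_mult[OF I f(2)])
      moreover have "[:[:c:]:] * f \<in> homogeneous_part n"
        using f(3) by (simp add: homogeneous_part_def)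
      moreover have "poly ([:[:c:]:] * f) 1 = Polynomial.smult c v" by (simp add: f(1))
      ultimately show ?thesis unfolding V_def by (metis IntI imageI)
    qed
    show "poly.coeff v i = 0" if "v \<in> V" "Suc n \<le> i" for v i
      using that by (auto simp: V_def coeff_poly_1_homogeneous)
  qed
  then obtain r T where "finite T"
    and inj: "\<And>t v. \<lbrakk>t \<notin> T; v \<in> V; [:-t, 1:] ^ r dvd v\<rbrakk> \<Longrightarrow> v = 0"
    and surj: "\<And>t h. t \<notin> T \<Longrightarrow> \<exists>v\<in>V. [:-t, 1:] ^ r dvd h - v"
    using lin_span_generic by metis
  have "mult_max_rank I (linear_form a b) d i"
    if a: "a \<noteq> 0" and t: "- b / a \<notin> T" and n: "i + d = n" for a b d i
  proof -
    define L where "L = linear_form a b"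
    \<comment> \<open>The double negation matches \<open>[:-t, 1:]\<close> at
      \<open>t = - b / a\<close>, the root of the dehomogenised form.\<close>
    define p where "p = [:- (- b / a), 1:]"
    have L1: "poly L 1 = Polynomial.smult a p"
      using a by (simp add: L_def p_def linear_form_def)
    have Ln: "L ^ d * f \<in> homogeneous_part n" if "f \<in> homogeneous_part i" for f
      using homogeneous_part_mult[OF linear_form_power_homogeneous[of a b d] that]
      by (simp add: L_def add.commute flip: n)
    have "L \<noteq> 0" using a by (auto simp: L_def linear_form_def)
    show ?thesis
    proof (cases "r \<le> d")
      case True
      have "inj_on (mult_map I (L ^ d)) (quotient_part I i)"
      proof (rule inj_onI)
        fix C D assume "C \<in> quotient_part I i" "D \<in> quotient_part I i"
          and eq: "mult_map I (L ^ d) C = mult_map I (L ^ d) D"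
        then obtain f g where fg: "f \<in> homogeneous_part i" "g \<in> homogeneous_part i"
          and CD: "C = I +>\<^bsub>Kxy\<^esub> f" "D = I +>\<^bsub>Kxy\<^esub> g"
          by (auto simp: quotient_part_def)
        define h where "h = L ^ d * (f - g)"
        have "h \<in> I"
          using eq by (simp add: CD mult_map_coset[OF I] coset_Kxy_eq_iff[OF I] h_def right_diff_distrib)
        moreover have h: "h \<in> homogeneous_part n"
          unfolding h_def by (intro Ln homogeneous_part_diff fg)
        ultimately have "poly h 1 \<in> V" by (auto simp: V_def)
        moreover have "p ^ r dvd poly h 1"
          using True by (simp add: h_def L1 smult_power dvd_smult le_imp_power_dvd dvd_mult2)
        ultimately have "poly h 1 = 0" using inj t unfolding p_def by blast
        then have "h = 0" using h by (rule homogeneous_eq_0_if_poly_1[rotated])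
        \<comment> \<open>Since \<open>R\<close> is a domain, \<open>h = 0\<close> gives
          \<open>f = g\<close> itself, not only a congruence modulo \<open>I\<close>.\<close>
        then show "C = D" using \<open>L \<noteq> 0\<close> by (simp add: h_def CD)
      qed
      then show ?thesis by (simp add: mult_max_rank_def L_def)
    next
      case False
      have "mult_map I (L ^ d) ` quotient_part I i = quotient_part I (i + d)"
      proof (intro equalityI subsetI)
        fix C assume "C \<in> mult_map I (L ^ d) ` quotient_part I i"
        then show "C \<in> quotient_part I (i + d)"
          using Ln n by (auto simp: quotient_part_def mult_map_coset[OF I])
      next
        fix C assume "C \<in> quotient_part I (i + d)"
        then obtain g where g: "g \<in> homogeneous_part n" and C: "C = I +>\<^bsub>Kxy\<^esub> g"
          using n by (auto simp: quotient_part_def)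
        \<comment> \<open>Correcting \<open>g\<close> by an element of \<open>I\<close> makes the
          difference divisible by \<open>p ^ r\<close>, hence by \<open>p ^ d\<close> as
          \<open>d < r\<close>.\<close>
        obtain f where f: "f \<in> I" "f \<in> homogeneous_part n" and dvd: "p ^ r dvd poly g 1 - poly f 1"
          using surj[OF t, of "poly g 1"] unfolding V_def p_def by auto
        have gf: "g - f \<in> homogeneous_part n" using g f(2) by (rule homogeneous_part_diff)
        have "p ^ d dvd poly (g - f) 1"
          using dvd False by (auto intro: power_le_dvd)
        then have "poly L 1 ^ d dvd poly (g - f) 1"
          using a by (simp add: L1 smult_power smult_dvd_iff)
        then obtain q where q: "poly (g - f) 1 = poly L 1 ^ d * q" by (elim dvdE)
        \<comment> \<open>Each factor \<open>poly L 1\<close> has degree exactly one because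
          \<open>a\<close> is nonzero, so the cofactor \<open>q\<close> has degree at most
          \<open>n - d = i\<close> and lifts to a form of degree \<open>i\<close>.\<close>
        have "Polynomial.degree q \<le> i"
        proof (cases "q = 0")
          case False
          have "Polynomial.degree (poly (g - f) 1) \<le> n"
            by (rule degree_le) (simp add: coeff_poly_1_homogeneous[OF gf] del: poly_diff)
          moreover have "Polynomial.degree (poly L 1) = 1" "poly L 1 \<noteq> 0"
            using a by (auto simp: L1 p_def)
          ultimately show ?thesis
            unfolding q using False n by (simp add: degree_mult_eq degree_power_eq)
        qed simp
        then obtain h where h: "h \<in> homogeneous_part i" "poly h 1 = q"
          using ex_homogeneous_poly_1 by blast
        have "L ^ d * h - (g - f) \<in> homogeneous_part n"
          using Ln[OF h(1)] gf by (rule homogeneous_part_diff)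
        then have "L ^ d * h - (g - f) = 0"
          by (rule homogeneous_eq_0_if_poly_1) (use q h(2) in simp)
        then have "g - L ^ d * h = f" by (simp add: algebra_simps)
        then have "C = mult_map I (L ^ d) (I +>\<^bsub>Kxy\<^esub> h)"
          using f(1) by (simp add: C mult_map_coset[OF I] coset_Kxy_eq_iff[OF I])
        then show "C \<in> mult_map I (L ^ d) ` quotient_part I i"
          using h(1) by (auto simp: quotient_part_def)
      qed
      then show ?thesis by (simp add: mult_max_rank_def L_def)
    qed
  qed
  then show ?thesis using \<open>finite T\<close> by blast
qed

text \<open>The target space is zero, so every linear form gives a surjection.\<close>

lemma mult_max_rank_of_zero_part:
  fixes I :: "'a::comm_ring_1 poly poly set"
  assumes I: "ideal I Kxy" and zero: "homogeneous_part (i + d) \<subseteq> I"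
  shows "mult_max_rank I (linear_form a b) d i"
proof -
  have "mult_map I (linear_form a b ^ d) ` quotient_part I i = quotient_part I (i + d)"
  proof (intro equalityI subsetI)
    fix C assume "C \<in> mult_map I (linear_form a b ^ d) ` quotient_part I i"
    then show "C \<in> quotient_part I (i + d)"
      using homogeneous_part_mult[OF linear_form_power_homogeneous]
      by (fastforce simp: quotient_part_def mult_map_coset[OF I] add.commute)
  next
    fix C assume "C \<in> quotient_part I (i + d)"
    then obtain g where "g \<in> I" "C = I +>\<^bsub>Kxy\<^esub> g"
      using zero by (auto simp: quotient_part_def)
    then have "C = mult_map I (linear_form a b ^ d) (I +>\<^bsub>Kxy\<^esub> 0)"
      by (simp add: mult_map_coset[OF I] coset_Kxy_eq_iff[OF I])
    moreover have "0 \<in> homogeneous_part i" by (simp add: homogeneous_part_def)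
    ultimately show "C \<in> mult_map I (linear_form a b ^ d) ` quotient_part I i"
      unfolding quotient_part_def by blast
  qed
  then show ?thesis by (simp add: mult_max_rank_def)
qed

section \<open>From finitely many exceptional values to a general linear form\<close>

lemma for_general_linear_form_cofinite:
  fixes T :: "'a::field_char_0 set"
  assumes "finite T" and P: "\<And>a b. \<lbrakk>a \<noteq> 0; - b / a \<notin> T\<rbrakk> \<Longrightarrow> P (linear_form a b)"
  shows "for_general_linear_form P"
proof -
  \<comment> \<open>In the coordinates \<open>(a, b)\<close> this is \<open>a\<close> times the
    product of the lines \<open>b + t a\<close>; its zeros are the excluded pairs.\<close>
  define F :: "'a poly poly" where "F = [:[:0, 1:]:] * (\<Prod>t\<in>T. [:[:0, t:], 1:])"
  have F: "poly (poly F [:b:]) a = a * (\<Prod>t\<in>T. b + t * a)" for a b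
    by (simp add: F_def poly_prod algebra_simps)
  define U where "U = {linear_form a b | a b. \<exists>G\<in>{F}. poly (poly G [:b:]) a \<noteq> 0}"
  have "zariski_open_linear_forms U"
    unfolding zariski_open_linear_forms_def U_def by blast
  moreover have "U \<noteq> {}"
  proof -
    \<comment> \<open>A field of characteristic zero is infinite; the form \<open>x - t y\<close>
      then lies in \<open>U\<close>.\<close>
    obtain t where "t \<notin> T"
      using ex_new_if_finite[OF infinite_UNIV_char_0 assms(1)] by blast
    then have "poly (poly F [:- t:]) 1 \<noteq> 0"
      using assms(1) by (auto simp: F)
    then show ?thesis unfolding U_def by blast
  qed
  moreover have "P L" if "L \<in> U" for L
  proof -
    obtain a b where L: "L = linear_form a b" and "poly (poly F [:b:]) a \<noteq> 0"
      using \<open>L \<in> U\<close> by (auto simp: U_def)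
    then have "a \<noteq> 0" and nz: "\<forall>t\<in>T. b + t * a \<noteq> 0"
      using assms(1) by (auto simp: F)
    then have "- b / a \<notin> T" by fastforce
    then show ?thesis unfolding L using \<open>a \<noteq> 0\<close> by (intro P)
  qed
  ultimately show ?thesis unfolding for_general_linear_form_def by blast
qed

theorem proposition4p4:
  fixes I :: "'a::field_char_0 poly poly set"
  assumes "homogeneous_ideal I" and "artinian_ideal I"
  shows "strong_lefschetz I \<and> weak_lefschetz I"
proof -
  have I: "ideal I Kxy" using assms(1) by (simp add: homogeneous_ideal_def)
  obtain N where N: "\<And>n. n \<ge> N \<Longrightarrow> homogeneous_part n \<subseteq> I"
    using artinian_homogeneous_ideal_contains_parts[OF assms] by blast
  obtain T where T: "\<And>n. finite (T n)"
    and rank: "\<And>n a b d i. \<lbrakk>a \<noteq> 0; - b / a \<notin> T n; i + d = n\<rbrakk> \<Longrightarrow>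
      mult_max_rank I (linear_form a b) d i"
    using mult_max_rank_generic[OF I] by metis
  \<comment> \<open>Target degrees from \<open>N\<close> on impose no condition on the form, so a
    finite union of exceptional sets suffices for all \<open>d\<close> and \<open>i\<close>; the
    weak property is the instance \<open>d = 1\<close>.\<close>
  have "mult_max_rank I (linear_form a b) d i"
    if "a \<noteq> 0" "- b / a \<notin> (\<Union>n<N. T n)" for a b d i
  proof (cases "i + d < N")
    case True
    then show ?thesis using that by (intro rank[of a b "i + d"]) auto
  next
    case False
    then show ?thesis by (intro mult_max_rank_of_zero_part[OF I] N) simp
  qed
  then show ?thesis
    unfolding strong_lefschetz_def weak_lefschetz_def using T
    by (auto intro!: for_general_linear_form_cofinite[of "\<Union>n<N. T n"])
qed

end
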